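(* Let $(X_1,\preceq_1)$ and $(X_2,\preceq_2)$ be two topological posets that are complete $\wedge$-semilattices, and suppose that $(X_1,\preceq_1)$ is locally compact and order-connected. Then every continuous $\wedge$-homomorphism $f:X_1\to X_2$ is a complete $\wedge$-homomorphism; that is, $f(\bigwedge S)=\bigwedge f(S)$ for every nonempty $S\subseteq X_1$.
   Context: A topological poset is a poset $(X,\preceq)$ with $X$ a nonempty topological space such that $\preceq$ is a closed subset of $X\times X$ (product topology). A poset is a complete $\wedge$-semilattice if the greatest lower bound $\bigwedge S$ exists for every nonempty subset $S$. (Continuity of $\wedge$ is not assumed.) Writing $x^{\downarrow}:=\{z:z\preceq x\}$ and $x^{\uparrow}:=\{z:x\preceq z\}$, a topological poset is order-connected if $x^{\uparrow}\cap y^{\downarrow}$ is a connected subset for all $x\preceq y$. A map $f:X_1\to X_2$ is an $\wedge$-homomorphism if $f(x\wedge y)=f(x)\wedge f(y)$ for all $x,y\in X_1$. *)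

theory Defs
  imports "HOL-Analysis.Analysis"
begin

text \<open>
  A poset is a relation \<open>r\<close> with \<open>partial_order_on A r\<close>, which forces \<open>A = Field r\<close>; the space
  is an abstract topology \<open>X\<close> with \<open>topspace X = A\<close>. For a point \<open>x\<close>, the down-set and the up-set
  of \<open>x\<close> are the library's \<open>under r x\<close> and \<open>above r x\<close>, and the set of lower bounds of \<open>S\<close> is
  \<open>Under r S\<close>.
\<close>

definition topological_poset :: "'a topology \<Rightarrow> 'a rel \<Rightarrow> bool" where
  "topological_poset X r \<longleftrightarrow>
     topspace X \<noteq> {} \<and> partial_order_on (topspace X) r \<and> closedin (prod_topology X X) r"

definition is_glb :: "'a rel \<Rightarrow> 'a set \<Rightarrow> 'a \<Rightarrow> bool" where
  "is_glb r S g \<longleftrightarrow> g \<in> Under r S \<and> (\<forall>z \<in> Under r S. (z, g) \<in> r)"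

text \<open>Only meaningful if a greatest lower bound exists; it is then unique by antisymmetry.\<close>

definition Meet :: "'a rel \<Rightarrow> 'a set \<Rightarrow> 'a" where
  "Meet r S = (THE g. is_glb r S g)"

definition meet :: "'a rel \<Rightarrow> 'a \<Rightarrow> 'a \<Rightarrow> 'a" where
  "meet r x y = Meet r {x, y}"

definition complete_meet_semilattice :: "'a rel \<Rightarrow> bool" where
  "complete_meet_semilattice r \<longleftrightarrow>
     partial_order_on (Field r) r \<and> (\<forall>S. S \<noteq> {} \<and> S \<subseteq> Field r \<longrightarrow> (\<exists>g. is_glb r S g))"

definition order_connected :: "'a topology \<Rightarrow> 'a rel \<Rightarrow> bool" where
  "order_connected X r \<longleftrightarrow> (\<forall>x y. (x, y) \<in> r \<longrightarrow> connectedin X (above r x \<inter> under r y))"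

definition meet_homomorphism :: "'a rel \<Rightarrow> 'b rel \<Rightarrow> ('a \<Rightarrow> 'b) \<Rightarrow> bool" where
  "meet_homomorphism r r' f \<longleftrightarrow>
     f \<in> Field r \<rightarrow> Field r' \<and>
     (\<forall>x \<in> Field r. \<forall>y \<in> Field r. f (meet r x y) = meet r' (f x) (f y))"

definition complete_meet_homomorphism :: "'a rel \<Rightarrow> 'b rel \<Rightarrow> ('a \<Rightarrow> 'b) \<Rightarrow> bool" where
  "complete_meet_homomorphism r r' f \<longleftrightarrow>
     f \<in> Field r \<rightarrow> Field r' \<and>
     (\<forall>S. S \<noteq> {} \<and> S \<subseteq> Field r \<longrightarrow> f (Meet r S) = Meet r' (f ` S))"

lemma Field_partial_order_on: "partial_order_on A r \<Longrightarrow> Field r = A"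
  by (auto simp: order_on_defs refl_on_def Field_def)

lemma Meet_eqI:
  assumes "partial_order_on A r" and "is_glb r S g"
  shows "Meet r S = g"
  unfolding Meet_def using assms
  by (intro the_equality) (auto simp: is_glb_def order_on_defs antisym_def)

end

theory Submission
  imports Defs
begin

text \<open>
  The continuity of \<open>f\<close> lets an infinite meet be replaced by a finite one. Write \<open>g\<close> for the
  meet of \<open>S\<close>. Every neighbourhood \<open>V\<close> of \<open>g\<close> contains the meet of some finite nonempty subset of
  \<open>S\<close> (\<open>finite_Meet_in_neighbourhood\<close>): shrink \<open>V\<close> to an open set \<open>W\<close> with compact closure; if no
  such finite meet lay in \<open>W\<close>, each order interval from \<open>g\<close> to a finite meet, being connected and
  containing \<open>g\<close>, would cross the frontier of \<open>W\<close>. As the frontier is compact and order intervals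
  are closed, some frontier point would lie above \<open>g\<close> and below all of \<open>S\<close>, so would be \<open>g\<close>
  itself, which is interior to \<open>W\<close>.

  Now let \<open>z\<close> be the meet of \<open>f ` S\<close>; since \<open>f\<close> is monotone, \<open>f g\<close> lies below \<open>z\<close>. Being a lower
  bound of \<open>f ` S\<close>, \<open>z\<close> lies below the image of the meet of every finite nonempty subset of \<open>S\<close>
  (\<open>below_image_finite_Meet\<close>). If \<open>z\<close> were not below \<open>f g\<close>, the points whose image is not above
  \<open>z\<close> would form a neighbourhood of \<open>g\<close>, because up-sets of points are closed, and this
  neighbourhood would contain no finite meet.
\<close>

section \<open>Meets\<close>

lemma Meet_is_glb:
  assumes "complete_meet_semilattice r" and "S \<noteq> {}" and "S \<subseteq> Field r"
  shows "is_glb r S (Meet r S)"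
proof -
  obtain g where g: "is_glb r S g"
    using assms unfolding complete_meet_semilattice_def by blast
  moreover have "Meet r S = g"
    using assms(1) g by (intro Meet_eqI) (auto simp: complete_meet_semilattice_def)
  ultimately show ?thesis by simp
qed

lemma Meet_in_Field:
  assumes "complete_meet_semilattice r" and "S \<noteq> {}" and "S \<subseteq> Field r"
  shows "Meet r S \<in> Field r"
  using Meet_is_glb[OF assms] by (auto simp: is_glb_def Under_def)

lemma Meet_lower:
  assumes "complete_meet_semilattice r" and "S \<subseteq> Field r" and "s \<in> S"
  shows "(Meet r S, s) \<in> r"
  using Meet_is_glb[of r S] assms by (auto simp: is_glb_def Under_def)

lemma Meet_greatest:
  assumes "complete_meet_semilattice r" and "S \<noteq> {}" and "S \<subseteq> Field r"
    and "\<And>s. s \<in> S \<Longrightarrow> (z, s) \<in> r"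
  shows "(z, Meet r S) \<in> r"
proof -
  have "z \<in> Under r S"
    using assms(2,4) by (auto simp: Under_def intro: FieldI1)
  then show ?thesis
    using Meet_is_glb[OF assms(1-3)] by (auto simp: is_glb_def)
qed

lemma complete_meet_semilattice_trans:
  assumes "complete_meet_semilattice r" and "(x, y) \<in> r" and "(y, z) \<in> r"
  shows "(x, z) \<in> r"
  using assms by (auto simp: complete_meet_semilattice_def order_on_defs elim: transE)

lemma complete_meet_semilattice_antisym:
  assumes "complete_meet_semilattice r" and "(x, y) \<in> r" and "(y, x) \<in> r"
  shows "x = y"
  using assms by (auto simp: complete_meet_semilattice_def order_on_defs elim: antisymD)

lemma Meet_insert:
  assumes r: "complete_meet_semilattice r"
    and x: "x \<in> Field r" and F: "F \<noteq> {}" "F \<subseteq> Field r"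
  shows "Meet r (insert x F) = meet r x (Meet r F)"
proof (rule complete_meet_semilattice_antisym[OF r])
  note MF = Meet_in_Field[OF r F]
  show "(Meet r (insert x F), meet r x (Meet r F)) \<in> r"
    unfolding meet_def using x F MF
    by (auto intro!: Meet_greatest[OF r] intro: Meet_lower[OF r])
  have low: "(meet r x (Meet r F), x) \<in> r" "(meet r x (Meet r F), Meet r F) \<in> r"
    unfolding meet_def using x MF by (auto intro!: Meet_lower[OF r])
  show "(meet r x (Meet r F), Meet r (insert x F)) \<in> r"
  proof (rule Meet_greatest[OF r])
    fix s assume "s \<in> insert x F"
    then show "(meet r x (Meet r F), s) \<in> r"
      using low Meet_lower[OF r F(2)] complete_meet_semilattice_trans[OF r] by blast
  qed (use x F in auto)
qed

lemma monotone_meet_homomorphism: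
  assumes r: "complete_meet_semilattice r" and r': "complete_meet_semilattice r'"
    and f: "meet_homomorphism r r' f" and xy: "(x, y) \<in> r"
  shows "(f x, f y) \<in> r'"
proof -
  have F: "x \<in> Field r" "y \<in> Field r"
    using xy by (auto intro: FieldI1 FieldI2)
  have "(x, x) \<in> r"
    using r F by (auto simp: complete_meet_semilattice_def order_on_defs elim: refl_onD)
  then have "(x, meet r x y) \<in> r" "(meet r x y, x) \<in> r"
    unfolding meet_def using xy F by (auto intro: Meet_greatest[OF r] Meet_lower[OF r])
  then have "meet r x y = x"
    using complete_meet_semilattice_antisym[OF r] by blast
  then have fx: "f x = meet r' (f x) (f y)"
    using f F by (metis meet_homomorphism_def)
  have "(meet r' (f x) (f y), f y) \<in> r'"
    unfolding meet_def using f F by (intro Meet_lower[OF r']) (auto simp: meet_homomorphism_def)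
  then show ?thesis
    using fx by simp
qed

lemma below_image_finite_Meet:
  assumes r: "complete_meet_semilattice r" and r': "complete_meet_semilattice r'"
    and f: "meet_homomorphism r r' f"
    and "finite F" "F \<noteq> {}" "F \<subseteq> Field r"
    and "\<And>x. x \<in> F \<Longrightarrow> (z, f x) \<in> r'"
  shows "(z, f (Meet r F)) \<in> r'"
  using assms(4-7)
proof (induction F rule: finite_ne_induct)
  case (singleton x)
  then have x: "x \<in> Field r" by simp
  have "Meet r {x} = x"
  proof (rule complete_meet_semilattice_antisym[OF r])
    show "(x, Meet r {x}) \<in> r"
      using r x by (auto intro!: Meet_greatest[OF r]
          simp: complete_meet_semilattice_def order_on_defs elim: refl_onD)
  qed (use x in \<open>auto intro: Meet_lower[OF r]\<close>)
  then show ?case using singleton by simp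
next
  case (insert x F)
  have M: "Meet r F \<in> Field r" and x: "x \<in> Field r"
    using insert Meet_in_Field[OF r] by auto
  have "(z, meet r' (f x) (f (Meet r F))) \<in> r'"
    unfolding meet_def using insert M x f
    by (intro Meet_greatest[OF r']) (auto simp: meet_homomorphism_def)
  also have "meet r' (f x) (f (Meet r F)) = f (meet r x (Meet r F))"
    using f x M by (simp add: meet_homomorphism_def)
  also have "meet r x (Meet r F) = Meet r (insert x F)"
    using insert by (intro Meet_insert[OF r, symmetric]) auto
  finally show ?case .
qed

section \<open>Closed partial orders\<close>

lemma topological_poset_Field: "topological_poset X r \<Longrightarrow> Field r = topspace X"
  by (auto simp: topological_poset_def Field_partial_order_on)

lemma closedin_above:
  assumes "topological_poset X r" and "x \<in> topspace X"
  shows "closedin X (above r x)"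
proof -
  have "continuous_map X (prod_topology X X) (\<lambda>y. (x, y))"
    using assms(2) by (simp add: continuous_map_pairedI)
  then have "closedin X {y \<in> topspace X. (x, y) \<in> r}"
    using assms(1) closedin_continuous_map_preimage unfolding topological_poset_def by blast
  also have "{y \<in> topspace X. (x, y) \<in> r} = above r x"
    using topological_poset_Field[OF assms(1)] by (auto simp: above_def intro: FieldI2)
  finally show ?thesis .
qed

lemma closedin_under:
  assumes "topological_poset X r" and "x \<in> topspace X"
  shows "closedin X (under r x)"
proof -
  have "continuous_map X (prod_topology X X) (\<lambda>y. (y, x))"
    using assms(2) by (simp add: continuous_map_pairedI)
  then have "closedin X {y \<in> topspace X. (y, x) \<in> r}"
    using assms(1) closedin_continuous_map_preimage unfolding topological_poset_def by blast
  also have "{y \<in> topspace X. (y, x) \<in> r} = under r x"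
    using topological_poset_Field[OF assms(1)] by (auto simp: under_def intro: FieldI1)
  finally show ?thesis .
qed

text \<open>By antisymmetry, the diagonal is the intersection of the closed order with its converse.\<close>

lemma topological_poset_Hausdorff:
  assumes "topological_poset X r"
  shows "Hausdorff_space X"
proof -
  have r: "closedin (prod_topology X X) r" "partial_order_on (topspace X) r"
    using assms by (auto simp: topological_poset_def)
  have sub: "r \<subseteq> topspace X \<times> topspace X"
    using closedin_subset[OF r(1)] by simp
  have "continuous_map (prod_topology X X) (prod_topology X X) (\<lambda>p. (snd p, fst p))"
    by (intro continuous_map_pairedI continuous_map_fst continuous_map_snd)
  from closedin_continuous_map_preimage[OF this r(1)]
  have "closedin (prod_topology X X)
      (r \<inter> {p \<in> topspace (prod_topology X X). (snd p, fst p) \<in> r})"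
    using r(1) by blast
  also have "r \<inter> {p \<in> topspace (prod_topology X X). (snd p, fst p) \<in> r}
      = (\<lambda>x. (x, x)) ` topspace X"
    using r(2) sub by (auto simp: order_on_defs dest: antisymD refl_onD)
  finally show ?thesis
    by (simp add: Hausdorff_space_closedin_diagonal)
qed

section \<open>Approximating a meet by finite meets\<close>

text \<open>
  Suppose that \<open>W \<subseteq> V\<close> is an open neighbourhood of the meet \<open>g\<close> with compact closure, and that
  no finite meet lies in \<open>W\<close>. Consider the traces on the frontier of \<open>W\<close> of the order intervals
  from \<open>g\<close> to the points of \<open>S\<close>. Any finitely many of these intervals contain the interval
  from \<open>g\<close> to the meet of their upper ends, which crosses the frontier because it is connected and
  leaves \<open>W\<close>; so the traces have the finite intersection property. A point common to all of
  them is a lower bound of \<open>S\<close> above \<open>g\<close>, so it is \<open>g\<close>; but an open set contains no point of its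
  frontier.
\<close>

lemma finite_Meet_in_neighbourhood:
  assumes X: "topological_poset X r" and r: "complete_meet_semilattice r"
    and lc: "locally_compact_space X" and oc: "order_connected X r"
    and S: "S \<noteq> {}" "S \<subseteq> Field r"
    and V: "openin X V" "Meet r S \<in> V"
  obtains F where "finite F" "F \<noteq> {}" "F \<subseteq> S" "Meet r F \<in> V"
proof -
  define g where "g = Meet r S"
  have Field: "Field r = topspace X"
    using X by (rule topological_poset_Field)
  have g: "g \<in> topspace X"
    using Meet_in_Field[OF r S] by (simp add: g_def Field)
  have refl: "(x, x) \<in> r" if "x \<in> topspace X" for x
    using X that by (auto simp: topological_poset_def order_on_defs elim: refl_onD)
  obtain U K where UK: "openin X U" "compactin X K" "g \<in> U" "U \<subseteq> K"
    using lc g unfolding locally_compact_space_def by blast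
  define W where "W = U \<inter> V"
  have W: "openin X W" "g \<in> W" "W \<subseteq> V"
    using UK V by (auto simp: W_def g_def)
  have "closedin X K"
    using topological_poset_Hausdorff[OF X] UK(2) by (rule compactin_imp_closedin)
  then have "X frontier_of W \<subseteq> K"
    using closure_of_minimal[of W K X] UK(4) by (auto simp: W_def frontier_of_def)
  then have comp: "compactin X (X frontier_of W)"
    using closed_compactin[OF UK(2)] closedin_frontier_of by blast
  have "\<exists>F. finite F \<and> F \<noteq> {} \<and> F \<subseteq> S \<and> Meet r F \<in> W"
  proof (rule ccontr)
    assume no: "\<nexists>F. finite F \<and> F \<noteq> {} \<and> F \<subseteq> S \<and> Meet r F \<in> W"
    define I where "I s = above r g \<inter> under r s" for s
    have crossing: "X frontier_of W \<inter> \<Inter>(I ` F) \<noteq> {}"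
      if F: "finite F" "F \<noteq> {}" "F \<subseteq> S" for F
    proof -
      let ?m = "Meet r F"
      have FF: "F \<subseteq> Field r"
        using F(3) S(2) by blast
      have gm: "(g, ?m) \<in> r"
        using F Meet_lower[OF r S(2)] by (auto simp: g_def intro!: Meet_greatest[OF r _ FF])
      have m: "?m \<in> topspace X"
        using Meet_in_Field[OF r F(2) FF] Field by simp
      have con: "connectedin X (I ?m)"
        using oc gm by (auto simp: order_connected_def I_def)
      have "g \<in> I ?m \<inter> W"
        using gm refl[OF g] W by (auto simp: I_def above_def under_def)
      moreover have "?m \<in> I ?m - W"
        using gm refl[OF m] no F by (auto simp: I_def above_def under_def)
      ultimately have "I ?m \<inter> X frontier_of W \<noteq> {}"
        using con by (intro connectedin_Int_frontier_of) auto
      moreover have "I ?m \<subseteq> \<Inter>(I ` F)"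
        using Meet_lower[OF r FF] complete_meet_semilattice_trans[OF r]
        unfolding I_def under_def by blast
      ultimately show ?thesis by blast
    qed
    have "X frontier_of W \<inter> \<Inter>(I ` S) \<noteq> {}"
    proof -
      have "closedin X (I s)" if "s \<in> S" for s
        unfolding I_def using that S(2) g Field
        by (intro closedin_Int closedin_above[OF X] closedin_under[OF X]) auto
      moreover have "X frontier_of W \<inter> \<Inter>\<F> \<noteq> {}" if fin: "finite \<F>" and sub: "\<F> \<subseteq> I ` S" for \<F>
      proof -
        obtain F where F: "finite F" "F \<subseteq> S" "\<F> = I ` F"
          using finite_subset_image[OF fin sub] by blast
        obtain s where "s \<in> S"
          using S(1) by blast
        \<comment> \<open>The extra point \<open>s\<close> handles the empty subfamily: \<open>crossing\<close> concerns nonempty sets only.\<close>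
        then show ?thesis
          using crossing[of "insert s F"] F by auto
      qed
      ultimately show ?thesis
        using comp unfolding compactin_fip by blast
    qed
    then obtain x where x: "x \<in> X frontier_of W" "\<And>s. s \<in> S \<Longrightarrow> x \<in> I s"
      by blast
    have "(x, g) \<in> r"
      using x(2) unfolding g_def by (auto simp: I_def under_def intro!: Meet_greatest[OF r S])
    moreover have "(g, x) \<in> r"
      using x(2) S(1) by (auto simp: I_def above_def)
    ultimately have "x = g"
      by (rule complete_meet_semilattice_antisym[OF r])
    then show False
      using x(1) W by (simp add: frontier_of_openin)
  qed
  then show ?thesis
    using W(3) that by blast
qed

section \<open>Continuous meet homomorphisms\<close>

theorem theorem22:
  fixes X1 :: "'a topology" and r1 :: "'a rel"
    and X2 :: "'b topology" and r2 :: "'b rel"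
    and f :: "'a \<Rightarrow> 'b"
  assumes "topological_poset X1 r1" and "complete_meet_semilattice r1"
    and "topological_poset X2 r2" and "complete_meet_semilattice r2"
    and "locally_compact_space X1" and "order_connected X1 r1"
    and "continuous_map X1 X2 f" and "meet_homomorphism r1 r2 f"
  shows "complete_meet_homomorphism r1 r2 f"
  unfolding complete_meet_homomorphism_def
proof (intro conjI allI impI)
  show fF: "f \<in> Field r1 \<rightarrow> Field r2"
    using assms(8) by (simp add: meet_homomorphism_def)
  fix S :: "'a set"
  assume "S \<noteq> {} \<and> S \<subseteq> Field r1"
  then have S: "S \<noteq> {}" "S \<subseteq> Field r1" by auto
  have fS: "f ` S \<noteq> {}" "f ` S \<subseteq> Field r2"
    using S fF by auto
  note Field1 = topological_poset_Field[OF assms(1)] and Field2 = topological_poset_Field[OF assms(3)]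
  define g z where "g = Meet r1 S" and "z = Meet r2 (f ` S)"
  have g: "g \<in> topspace X1"
    using Meet_in_Field[OF assms(2) S] Field1 by (simp add: g_def)
  have z: "z \<in> topspace X2"
    using Meet_in_Field[OF assms(4) fS] Field2 by (simp add: z_def)
  have "(f g, z) \<in> r2"
    unfolding z_def
  proof (rule Meet_greatest[OF assms(4) fS])
    fix y assume "y \<in> f ` S"
    then show "(f g, y) \<in> r2"
      using monotone_meet_homomorphism[OF assms(2,4,8)] Meet_lower[OF assms(2) S(2)]
      by (auto simp: g_def)
  qed
  moreover have "(z, f g) \<in> r2"
  proof (rule ccontr)
    assume nle: "(z, f g) \<notin> r2"
    define V where "V = {x \<in> topspace X1. f x \<in> topspace X2 - above r2 z}"
    have "openin X2 (topspace X2 - above r2 z)"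
      using closedin_above[OF assms(3) z] by blast
    then have V: "openin X1 V"
      unfolding V_def using assms(7) by (rule openin_continuous_map_preimage[rotated])
    have "Meet r1 S \<in> V"
      using nle g fF Field1 Field2 by (auto simp: V_def above_def g_def)
    with V obtain F where F: "finite F" "F \<noteq> {}" "F \<subseteq> S" "Meet r1 F \<in> V"
      by (rule finite_Meet_in_neighbourhood[OF assms(1,2,5,6) S])
    have "(z, f (Meet r1 F)) \<in> r2"
      using F S(2) Meet_lower[OF assms(4) fS(2)]
      by (intro below_image_finite_Meet[OF assms(2,4,8)]) (auto simp: z_def)
    with F(4) show False
      by (simp add: V_def above_def)
  qed
  ultimately show "f (Meet r1 S) = Meet r2 (f ` S)"
    using complete_meet_semilattice_antisym[OF assms(4)] by (simp add: g_def z_def)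
qed

end
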